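(* For every integer $n\geqslant 2$, the rank of the monoid $\mathcal{PIO}_{n}^{-}$ is $3n-3$.
   Context: $\Omega_n=\{1,\ldots,n\}$ with its natural order. A partial transformation of $\Omega_n$ is a map $\alpha$ from a subset $\operatorname{Dom}(\alpha)\subseteq\Omega_n$ (possibly empty) into $\Omega_n$, with image $\operatorname{Im}(\alpha)$. Maps are written on the right and composed from left to right: $x(\alpha\beta)=(x\alpha)\beta$, with $\operatorname{Dom}(\alpha\beta)=\{x\in\operatorname{Dom}(\alpha)\mid x\alpha\in\operatorname{Dom}(\beta)\}$. $\alpha$ is order-preserving if $x\leqslant y$ implies $x\alpha\leqslant y\alpha$ for all $x,y\in\operatorname{Dom}(\alpha)$, and order-decreasing if $x\alpha\leqslant x$ for all $x\in\operatorname{Dom}(\alpha)$. A subset $I\subseteq\Omega_n$ (possibly empty) is an interval if for all $x,y,z\in\Omega_n$, $x\leqslant y\leqslant z$ and $x,z\in I$ imply $y\in I$. $\mathcal{PIO}_n$ is the monoid, under composition, of all order-preserving partial transformations $\alpha$ of $\Omega_n$ such that $\operatorname{Dom}(\alpha)$ and $\operatorname{Im}(\alpha)$ are both intervals of $\Omega_n$ (it includes the empty transformation), and $\mathcal{PIO}_n^-$ is its submonoid of order-decreasing elements. The rank of a monoid $M$ is the minimum size of a subset $A\subseteq M$ such that the smallest submonoid of $M$ containing $A$ is $M$. *)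

theory Defs
  imports "HOL-Algebra.Group"
begin

definition Omega :: "nat \<Rightarrow> nat set" where
  "Omega n = {1..n}"

definition interval_of :: "nat \<Rightarrow> nat set \<Rightarrow> bool" where
  "interval_of n I \<longleftrightarrow> I \<subseteq> Omega n \<and>
     (\<forall>x\<in>Omega n. \<forall>y\<in>Omega n. \<forall>z\<in>Omega n. x \<le> y \<and> y \<le> z \<and> x \<in> I \<and> z \<in> I \<longrightarrow> y \<in> I)"

definition partial_transformation :: "nat \<Rightarrow> (nat \<rightharpoonup> nat) \<Rightarrow> bool" where
  "partial_transformation n \<alpha> \<longleftrightarrow> dom \<alpha> \<subseteq> Omega n \<and> ran \<alpha> \<subseteq> Omega n"

definition order_preserving :: "(nat \<rightharpoonup> nat) \<Rightarrow> bool" where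
  "order_preserving \<alpha> \<longleftrightarrow> (\<forall>x\<in>dom \<alpha>. \<forall>y\<in>dom \<alpha>. x \<le> y \<longrightarrow> the (\<alpha> x) \<le> the (\<alpha> y))"

definition order_decreasing :: "(nat \<rightharpoonup> nat) \<Rightarrow> bool" where
  "order_decreasing \<alpha> \<longleftrightarrow> (\<forall>x\<in>dom \<alpha>. the (\<alpha> x) \<le> x)"

text \<open>Maps act on the right and compose from left to right, so the product of
  \<open>\<alpha>\<close> and \<open>\<beta>\<close> is \<open>\<beta> \<circ>\<^sub>m \<alpha>\<close>.\<close>

definition PIO :: "nat \<Rightarrow> (nat \<rightharpoonup> nat) monoid" where
  "PIO n = \<lparr>carrier = {\<alpha>. partial_transformation n \<alpha> \<and> order_preserving \<alpha> \<and>
                           interval_of n (dom \<alpha>) \<and> interval_of n (ran \<alpha>)},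
            monoid.mult = (\<lambda>\<alpha> \<beta>. \<beta> \<circ>\<^sub>m \<alpha>),
            one = Some |` Omega n\<rparr>"

definition PIO_minus :: "nat \<Rightarrow> (nat \<rightharpoonup> nat) monoid" where
  "PIO_minus n = (PIO n)\<lparr>carrier := {\<alpha> \<in> carrier (PIO n). order_decreasing \<alpha>}\<rparr>"

definition submonoid_generated :: "('a, 'b) monoid_scheme \<Rightarrow> 'a set \<Rightarrow> 'a set" where
  "submonoid_generated M A = \<Inter> {H. submonoid H M \<and> A \<subseteq> H}"

text \<open>The value is meaningful only for finitely generated monoids; otherwise no \<open>k\<close>
  qualifies and \<open>LEAST\<close> is unspecified.  Finiteness is required because \<open>card\<close> of an
  infinite set is \<open>0\<close>.\<close>

definition monoid_rank :: "('a, 'b) monoid_scheme \<Rightarrow> nat" where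
  "monoid_rank M = (LEAST k. \<exists>A. A \<subseteq> carrier M \<and> finite A \<and> card A = k \<and>
                              submonoid_generated M A = carrier M)"

lemma PIO_closed:
  assumes "\<alpha> \<in> carrier (PIO n)" "\<beta> \<in> carrier (PIO n)"
  shows "\<beta> \<circ>\<^sub>m \<alpha> \<in> carrier (PIO n)"
proof -
  note a = assms[unfolded PIO_def, simplified]
  have "dom (\<beta> \<circ>\<^sub>m \<alpha>) \<subseteq> dom \<alpha>" "ran (\<beta> \<circ>\<^sub>m \<alpha>) \<subseteq> ran \<beta>"
    by (auto simp: map_comp_def ran_def split: option.splits)
  then have sub: "dom (\<beta> \<circ>\<^sub>m \<alpha>) \<subseteq> Omega n" "ran (\<beta> \<circ>\<^sub>m \<alpha>) \<subseteq> Omega n"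
    using a unfolding partial_transformation_def by blast+
  have mono: "p \<le> q" if "\<gamma> x = Some p" "\<gamma> y = Some q" "x \<le> y" "order_preserving \<gamma>" for \<gamma> x y p q
    using that unfolding order_preserving_def by (metis domI option.sel)
  have conv: "y \<in> I" if "interval_of n I" "x \<in> I" "z \<in> I" "x \<le> y" "y \<le> z" for I x y z
  proof -
    have "x \<in> Omega n" "z \<in> Omega n" using that unfolding interval_of_def by auto
    then have "y \<in> Omega n" using that by (auto simp: Omega_def)
    then show ?thesis using that \<open>x \<in> Omega n\<close> \<open>z \<in> Omega n\<close> unfolding interval_of_def by blast
  qed
  have op: "order_preserving (\<beta> \<circ>\<^sub>m \<alpha>)"
    unfolding order_preserving_def
  proof (intro ballI impI)
    fix x y assume xy: "x \<in> dom (\<beta> \<circ>\<^sub>m \<alpha>)" "y \<in> dom (\<beta> \<circ>\<^sub>m \<alpha>)" "x \<le> y"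
    then obtain p q p' q' where "\<alpha> x = Some p" "\<beta> p = Some p'" "\<alpha> y = Some q" "\<beta> q = Some q'"
      by (auto simp: map_comp_def split: option.splits)
    then show "the ((\<beta> \<circ>\<^sub>m \<alpha>) x) \<le> the ((\<beta> \<circ>\<^sub>m \<alpha>) y)"
      using mono[of \<alpha> x p y q] mono[of \<beta> p p' q q'] xy a by simp
  qed
  have idom: "interval_of n (dom (\<beta> \<circ>\<^sub>m \<alpha>))"
    unfolding interval_of_def
  proof (intro conjI ballI impI sub)
    fix x y z assume h: "x \<le> y \<and> y \<le> z \<and> x \<in> dom (\<beta> \<circ>\<^sub>m \<alpha>) \<and> z \<in> dom (\<beta> \<circ>\<^sub>m \<alpha>)"
    then obtain p r p' r' where pr: "\<alpha> x = Some p" "\<beta> p = Some p'" "\<alpha> z = Some r" "\<beta> r = Some r'"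
      by (auto simp: map_comp_def split: option.splits)
    have "y \<in> dom \<alpha>" using conv[of "dom \<alpha>" x z y] a h pr by blast
    then obtain q where q: "\<alpha> y = Some q" by blast
    have "q \<in> dom \<beta>"
      using conv[of "dom \<beta>" p r q] mono[OF pr(1) q] mono[OF q pr(3)] a h pr by blast
    then show "y \<in> dom (\<beta> \<circ>\<^sub>m \<alpha>)" using q by auto
  qed
  have iran: "interval_of n (ran (\<beta> \<circ>\<^sub>m \<alpha>))"
    unfolding interval_of_def
  proof (intro conjI ballI impI sub)
    fix x y z assume h: "x \<le> y \<and> y \<le> z \<and> x \<in> ran (\<beta> \<circ>\<^sub>m \<alpha>) \<and> z \<in> ran (\<beta> \<circ>\<^sub>m \<alpha>)"
    then obtain u w p r where pr: "\<alpha> u = Some p" "\<beta> p = Some x" "\<alpha> w = Some r" "\<beta> r = Some z"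
      by (auto simp: ran_def map_comp_def split: option.splits)
    have "y \<in> ran \<beta>" using conv[of "ran \<beta>" x z y] a h pr by (meson ranI)
    then obtain m where m: "\<beta> m = Some y" by (auto simp: ran_def)
    show "y \<in> ran (\<beta> \<circ>\<^sub>m \<alpha>)"
    proof (cases "y = x \<or> y = z")
      case True
      then show ?thesis using h by auto
    next
      case False
      have "p \<le> m" using mono[OF m pr(2)] a h False by (meson antisym nle_le)
      moreover have "m \<le> r" using mono[OF pr(4) m] a h False by (meson antisym nle_le)
      ultimately have "m \<in> ran \<alpha>" using conv[of "ran \<alpha>" p r m] a pr by (meson ranI)
      then obtain v where "\<alpha> v = Some m" by (auto simp: ran_def)
      then have "(\<beta> \<circ>\<^sub>m \<alpha>) v = Some y" using m by simp
      then show ?thesis by (rule ranI)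
    qed
  qed
  show ?thesis using sub op idom iran by (simp add: PIO_def partial_transformation_def)
qed

lemma PIO_one: "Some |` Omega n \<in> carrier (PIO n)"
proof -
  have "dom (Some |` Omega n) = Omega n" "ran (Some |` Omega n) = Omega n"
    by (auto simp: restrict_map_def ran_def dom_def)
  then show ?thesis
    by (auto simp: PIO_def partial_transformation_def order_preserving_def interval_of_def)
qed

lemma monoid_PIO: "monoid (PIO n)"
proof
  fix x y assume "x \<in> carrier (PIO n)" "y \<in> carrier (PIO n)"
  then show "x \<otimes>\<^bsub>PIO n\<^esub> y \<in> carrier (PIO n)"
    using PIO_closed[of x n y] by (simp add: PIO_def)
next
  show "\<one>\<^bsub>PIO n\<^esub> \<in> carrier (PIO n)" using PIO_one by (simp add: PIO_def)
next
  fix x y z :: "nat \<rightharpoonup> nat"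
  show "x \<otimes>\<^bsub>PIO n\<^esub> y \<otimes>\<^bsub>PIO n\<^esub> z = x \<otimes>\<^bsub>PIO n\<^esub> (y \<otimes>\<^bsub>PIO n\<^esub> z)"
    by (auto simp: PIO_def map_comp_def fun_eq_iff split: option.splits)
next
  fix x assume "x \<in> carrier (PIO n)"
  then have s: "dom x \<subseteq> Omega n" "ran x \<subseteq> Omega n"
    by (auto simp: PIO_def partial_transformation_def)
  show "\<one>\<^bsub>PIO n\<^esub> \<otimes>\<^bsub>PIO n\<^esub> x = x"
  proof
    fix u
    show "(\<one>\<^bsub>PIO n\<^esub> \<otimes>\<^bsub>PIO n\<^esub> x) u = x u"
      using s(1) by (cases "x u") (auto simp: PIO_def map_comp_def restrict_map_def)
  qed
  show "x \<otimes>\<^bsub>PIO n\<^esub> \<one>\<^bsub>PIO n\<^esub> = x"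
    using s(2) by (auto simp: PIO_def map_comp_def fun_eq_iff restrict_map_def ran_def
        split: option.splits)
qed

lemma submonoid_PIO_minus: "submonoid (carrier (PIO_minus n)) (PIO n)"
proof
  show "carrier (PIO_minus n) \<subseteq> carrier (PIO n)" by (auto simp: PIO_minus_def)
next
  fix x y assume xy: "x \<in> carrier (PIO_minus n)" "y \<in> carrier (PIO_minus n)"
  then have d: "\<And>u v. x u = Some v \<Longrightarrow> v \<le> u" "\<And>u v. y u = Some v \<Longrightarrow> v \<le> u"
    by (auto simp: PIO_minus_def order_decreasing_def dom_def)
  have "order_decreasing (y \<circ>\<^sub>m x)"
    unfolding order_decreasing_def
  proof
    fix u assume "u \<in> dom (y \<circ>\<^sub>m x)"
    then obtain v w where "x u = Some v" "y v = Some w"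
      by (auto simp: map_comp_def split: option.splits)
    then show "the ((y \<circ>\<^sub>m x) u) \<le> u" using d[of u v] d[of v w] by simp
  qed
  then show "x \<otimes>\<^bsub>PIO n\<^esub> y \<in> carrier (PIO_minus n)"
    using PIO_closed[of x n y] xy by (simp add: PIO_minus_def PIO_def)
next
  show "\<one>\<^bsub>PIO n\<^esub> \<in> carrier (PIO_minus n)"
    using PIO_one[of n]
    by (auto simp: PIO_minus_def PIO_def order_decreasing_def restrict_map_def dom_def)
qed

lemma monoid_PIO_minus: "monoid (PIO_minus n)"
proof -
  have "PIO_minus n = (PIO n)\<lparr>carrier := carrier (PIO_minus n)\<rparr>"
    by (simp add: PIO_minus_def)
  then show ?thesis
    using submonoid.submonoid_is_monoid[OF submonoid_PIO_minus monoid_PIO] by metis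
qed

end

theory Submission
  imports Defs
begin

text \<open>Call a nonidentity element \<open>g\<close> of a monoid irreducible if \<open>\<beta>\<gamma> = g\<close> forces \<open>\<beta> = g\<close> or
  \<open>\<gamma> = g\<close>. Removing an irreducible element from the monoid leaves a submonoid, so every generating
  set contains every irreducible element. If the irreducible elements already generate, their
  number is the rank, and this is what happens here. The irreducible elements are

  \<^item> the maps \<open>collapse n i\<close> with \<open>1 \<le> i < n\<close>, defined everywhere, whose only repeated value is
    \<open>i\<close>, taken at \<open>i\<close> and \<open>i + 1\<close>;
  \<^item> the partial identities on the final segments \<open>{a..n}\<close> with \<open>2 \<le> a \<le> n\<close>;
  \<^item> the partial identities on the initial segments \<open>{1..b}\<close> with \<open>1 \<le> b < n\<close>,

  that is, three families of \<open>n - 1\<close> maps each.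

  Everything rests on one observation: since domain and image are intervals, a nonempty element is a
  function on some \<open>{a..b}\<close> that grows by \<open>0\<close> or \<open>1\<close> at each step (\<open>PIO_minus_interval_mapE\<close>).

  Generation: such a function extends to one on all of \<open>{1..n}\<close> with the same kind of steps, so the
  element is the product of the partial identities on \<open>{1..b}\<close> and \<open>{a..n}\<close> and a full map. A full
  map is a product of collapsing maps, because the last factor can be split off at the price of
  one more value (\<open>full_map_in_submonoid\<close>). The empty map is the product of the partial identities
  on \<open>{1..1}\<close> and \<open>{2..n}\<close>.

  Irreducibility: no factor moves a point up, so if the product fixes a point then so do both
  factors. Hence if a partial identity on a final or initial segment is a product, each factor
  extends it, and if both extensions were proper, the next point beyond the segment would lie in
  the domain of the product. For a collapsing map the first factor is squeezed between it and the
  identity, and its steps leave only these two possibilities.\<close>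

section \<open>Elements as interval maps with unit steps\<close>

definition interval_map :: "nat \<Rightarrow> nat \<Rightarrow> (nat \<Rightarrow> nat) \<Rightarrow> nat \<rightharpoonup> nat" where
  "interval_map a b f = (Some \<circ> f) |` {a..b}"

abbreviation interval_id :: "nat \<Rightarrow> nat \<Rightarrow> nat \<rightharpoonup> nat" where
  "interval_id a b \<equiv> interval_map a b (\<lambda>x. x)"

text \<open>The full map that identifies \<open>i\<close> with \<open>i + 1\<close> and closes the resulting gap by
  shifting everything above down by one.\<close>

definition collapse :: "nat \<Rightarrow> nat \<Rightarrow> nat \<rightharpoonup> nat" where
  "collapse n i = interval_map 1 n (\<lambda>x. if x \<le> i then x else x - 1)"

lemma interval_map_apply:
  "interval_map a b f x = (if a \<le> x \<and> x \<le> b then Some (f x) else None)"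
  by (simp add: interval_map_def restrict_map_def)

lemma PIO_minus_mult: "x \<otimes>\<^bsub>PIO_minus n\<^esub> y = y \<circ>\<^sub>m x"
  by (simp add: PIO_minus_def PIO_def)

lemma PIO_minus_one: "\<one>\<^bsub>PIO_minus n\<^esub> = interval_id 1 n"
  by (rule ext) (simp add: PIO_minus_def PIO_def Omega_def restrict_map_def interval_map_apply)

lemma unit_steps_mono:
  fixes f :: "nat \<Rightarrow> nat"
  assumes step: "\<And>x. a \<le> x \<Longrightarrow> x < b \<Longrightarrow> f (Suc x) = f x \<or> f (Suc x) = Suc (f x)"
    and "x \<le> y" "a \<le> x" "y \<le> b"
  shows "f x \<le> f y"
  using assms(2-4)
proof (induction y rule: dec_induct)
  case (step m)
  then show ?case using assms(1)[of m] by auto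
qed simp

lemma unit_steps_bounds:
  fixes f :: "nat \<Rightarrow> nat"
  assumes "f 1 = 1"
    and "\<And>x. 1 \<le> x \<Longrightarrow> x < n \<Longrightarrow> f (Suc x) = f x \<or> f (Suc x) = Suc (f x)"
    and "1 \<le> x" "x \<le> n"
  shows "1 \<le> f x \<and> f x \<le> x"
  using assms(3,4)
proof (induction x rule: dec_induct)
  case (step m)
  then show ?case using assms(2)[of m] by auto
qed (use assms(1) in simp)

text \<open>Unit steps make the image an interval by a discrete intermediate value argument.\<close>

lemma interval_map_in_PIO_minus:
  assumes "1 \<le> a" "b \<le> n"
    and low: "\<And>x. a \<le> x \<Longrightarrow> x \<le> b \<Longrightarrow> 1 \<le> f x \<and> f x \<le> x"
    and step: "\<And>x. a \<le> x \<Longrightarrow> x < b \<Longrightarrow> f (Suc x) = f x \<or> f (Suc x) = Suc (f x)"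
  shows "interval_map a b f \<in> carrier (PIO_minus n)"
proof -
  let ?\<alpha> = "interval_map a b f"
  have dom: "dom ?\<alpha> = {a..b}"
    by (auto simp: interval_map_apply dom_def)
  have ran: "ran ?\<alpha> = f ` {a..b}"
    by (auto simp: interval_map_apply ran_def)
  have mono: "f x \<le> f y" if "x \<le> y" "a \<le> x" "y \<le> b" for x y
    using step that by (rule unit_steps_mono)
  have ivt: "y \<in> f ` {a..b}" if "f u \<le> y" "y \<le> f w" "u \<in> {a..b}" "w \<in> {a..b}" for y u w
  proof -
    have "y \<in> f ` {a..b}" if "u \<le> w" "y \<le> f w" "a \<le> u" "w \<le> b" "f u \<le> y" for w
      using that
    proof (induction w rule: dec_induct)
      case base
      then show ?case by auto
    next
      case (step m)
      then show ?case using assms(4)[of m]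
        by (cases "y \<le> f m") (auto simp: image_iff intro!: bexI[of _ "Suc m"])
    qed
    moreover have "y = f u" if "w < u"
      using mono[of w u] \<open>f u \<le> y\<close> \<open>y \<le> f w\<close> \<open>u \<in> _\<close> \<open>w \<in> _\<close> that by simp
    ultimately show ?thesis using that by (cases "u \<le> w") auto
  qed
  have "f x \<in> Omega n" if "x \<in> {a..b}" for x
    using low[of x] that assms(2) by (auto simp: Omega_def)
  moreover have "{a..b} \<subseteq> Omega n" using assms(1,2) by (auto simp: Omega_def)
  ultimately have sub: "dom ?\<alpha> \<subseteq> Omega n" "ran ?\<alpha> \<subseteq> Omega n"
    unfolding dom ran by auto
  have "interval_of n (dom ?\<alpha>)"
    using sub(1) unfolding dom interval_of_def by auto
  moreover have "interval_of n (ran ?\<alpha>)"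
    using sub(2) ivt unfolding ran interval_of_def by blast
  moreover have "order_preserving ?\<alpha>"
    unfolding order_preserving_def dom using mono by (auto simp: interval_map_apply)
  moreover have "order_decreasing ?\<alpha>"
    unfolding order_decreasing_def dom using low by (auto simp: interval_map_apply)
  ultimately show ?thesis
    using sub by (simp add: PIO_minus_def PIO_def partial_transformation_def)
qed

lemma PIO_minus_bounds:
  assumes "\<alpha> \<in> carrier (PIO_minus n)" "\<alpha> x = Some y"
  shows "1 \<le> y" "y \<le> x" "x \<le> n"
proof -
  have "x \<in> Omega n" "y \<in> Omega n"
    using assms by (auto simp: PIO_minus_def PIO_def partial_transformation_def dom_def ran_def)
  moreover have "y \<le> x"
    using assms by (auto simp: PIO_minus_def order_decreasing_def dom_def)
  ultimately show "1 \<le> y" "y \<le> x" "x \<le> n" by (auto simp: Omega_def)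
qed

lemma PIO_minus_mono:
  assumes "\<alpha> \<in> carrier (PIO_minus n)" "\<alpha> x = Some p" "\<alpha> y = Some q" "x \<le> y"
  shows "p \<le> q"
proof -
  have "order_preserving \<alpha>" using assms(1) by (simp add: PIO_minus_def PIO_def)
  then show ?thesis
    using assms(2-4) unfolding order_preserving_def by (metis domI option.sel)
qed

lemma PIO_minus_dom_convex:
  assumes "\<alpha> \<in> carrier (PIO_minus n)" "x \<in> dom \<alpha>" "z \<in> dom \<alpha>" "x \<le> y" "y \<le> z"
  shows "y \<in> dom \<alpha>"
proof -
  have i: "interval_of n (dom \<alpha>)" using assms(1) by (simp add: PIO_minus_def PIO_def)
  then have "x \<in> Omega n" "z \<in> Omega n" using assms(2,3) by (auto simp: interval_of_def)
  moreover from this have "y \<in> Omega n" using assms(4,5) by (auto simp: Omega_def)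
  ultimately show ?thesis using i assms(2-5) unfolding interval_of_def by blast
qed

text \<open>A larger jump would leave a gap in the image: by monotonicity no other point of the
  domain can take the value \<open>p + 1\<close>.\<close>

lemma PIO_minus_unit_step:
  assumes "\<alpha> \<in> carrier (PIO_minus n)" "\<alpha> x = Some p" "\<alpha> (Suc x) = Some q"
  shows "q = p \<or> q = Suc p"
proof (rule ccontr)
  assume "\<not> ?thesis"
  then have pq: "Suc p < q" using PIO_minus_mono[OF assms] by simp
  have i: "interval_of n (ran \<alpha>)" using assms(1) by (simp add: PIO_minus_def PIO_def)
  have r: "p \<in> ran \<alpha>" "q \<in> ran \<alpha>" using assms by (auto intro: ranI)
  then have "p \<in> Omega n" "q \<in> Omega n" using i by (auto simp: interval_of_def)
  moreover from this have "Suc p \<in> Omega n" using pq by (auto simp: Omega_def)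
  ultimately have "Suc p \<in> ran \<alpha>"
    using i r pq unfolding interval_of_def by (meson le_SucI less_or_eq_imp_le order_refl)
  then obtain z where z: "\<alpha> z = Some (Suc p)" by (auto simp: ran_def)
  show False
  proof (cases "z \<le> x")
    case True
    then show False using PIO_minus_mono[OF assms(1) z assms(2)] by simp
  next
    case False
    then show False using PIO_minus_mono[OF assms(1,3) z] pq by simp
  qed
qed

text \<open>Together with \<open>interval_map_in_PIO_minus\<close> this describes the nonempty elements completely;
  it replaces the two interval conditions by a local condition on consecutive points.\<close>

lemma PIO_minus_interval_mapE:
  assumes "\<alpha> \<in> carrier (PIO_minus n)" "\<alpha> \<noteq> Map.empty"
  obtains a b f where "1 \<le> a" "a \<le> b" "b \<le> n" "\<alpha> = interval_map a b f"
    "\<And>x. a \<le> x \<Longrightarrow> x \<le> b \<Longrightarrow> 1 \<le> f x \<and> f x \<le> x"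
    "\<And>x. a \<le> x \<Longrightarrow> x < b \<Longrightarrow> f (Suc x) = f x \<or> f (Suc x) = Suc (f x)"
proof -
  define a b f where "a = Min (dom \<alpha>)" and "b = Max (dom \<alpha>)" and "f = the \<circ> \<alpha>"
  have "dom \<alpha> \<subseteq> {..n}" using PIO_minus_bounds(3)[OF assms(1)] by auto
  then have fin: "finite (dom \<alpha>)" by (rule finite_subset) simp
  have ne: "dom \<alpha> \<noteq> {}" using assms(2) by simp
  have ab: "a \<in> dom \<alpha>" "b \<in> dom \<alpha>" using fin ne by (simp_all add: a_def b_def)
  have dom: "x \<in> dom \<alpha> \<longleftrightarrow> a \<le> x \<and> x \<le> b" for x
    using PIO_minus_dom_convex[OF assms(1) ab, of x] Min_le[OF fin] Max_ge[OF fin]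
    unfolding a_def b_def by blast
  have eq: "\<alpha> = interval_map a b f"
  proof
    fix x show "\<alpha> x = interval_map a b f x"
      using dom[of x] by (auto simp: interval_map_apply f_def domIff)
  qed
  have bd: "1 \<le> f x \<and> f x \<le> x" if "a \<le> x" "x \<le> b" for x
    using PIO_minus_bounds[OF assms(1), of x "f x"] that by (simp add: eq interval_map_apply)
  have st: "f (Suc x) = f x \<or> f (Suc x) = Suc (f x)" if "a \<le> x" "x < b" for x
    using PIO_minus_unit_step[OF assms(1), of x "f x" "f (Suc x)"] that
    by (simp add: eq interval_map_apply)
  have "a \<le> b" using ab dom by blast
  moreover have "1 \<le> a" using bd[of a] \<open>a \<le> b\<close> by simp
  moreover have "b \<le> n" using ab(2) PIO_minus_bounds(3)[OF assms(1)] by auto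
  ultimately show ?thesis using that eq bd st by blast
qed

lemma interval_id_in_PIO_minus: "1 \<le> a \<Longrightarrow> b \<le> n \<Longrightarrow> interval_id a b \<in> carrier (PIO_minus n)"
  by (rule interval_map_in_PIO_minus) auto

lemma collapse_in_PIO_minus:
  assumes "1 \<le> i"
  shows "collapse n i \<in> carrier (PIO_minus n)"
  unfolding collapse_def by (rule interval_map_in_PIO_minus) (use assms in auto)

section \<open>The generators\<close>

definition PIO_minus_generators :: "nat \<Rightarrow> (nat \<rightharpoonup> nat) set" where
  "PIO_minus_generators n = collapse n ` {1..n - 1} \<union> (\<lambda>a. interval_id a n) ` {2..n}
     \<union> interval_id 1 ` {1..n - 1}"

lemma PIO_minus_generatorsE:
  assumes "g \<in> PIO_minus_generators n"
  obtains (collapse) i where "1 \<le> i" "i < n" "g = collapse n i"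
    | (upper) a where "2 \<le> a" "a \<le> n" "g = interval_id a n"
    | (lower) b where "1 \<le> b" "b < n" "g = interval_id 1 b"
proof -
  have lt: "i < n" if "i \<in> {1..n - 1}" for i using that by auto
  from assms consider "g \<in> collapse n ` {1..n - 1}" | "g \<in> (\<lambda>a. interval_id a n) ` {2..n}"
    | "g \<in> interval_id 1 ` {1..n - 1}"
    unfolding PIO_minus_generators_def by blast
  then show thesis
  proof cases
    case 1
    then obtain i where "i \<in> {1..n - 1}" "g = collapse n i" by (rule imageE)
    then show thesis using collapse[of i] lt[of i] by simp
  next
    case 2
    then show thesis using upper by auto
  next
    case 3
    then obtain b where "b \<in> {1..n - 1}" "g = interval_id 1 b" by (rule imageE)
    then show thesis using lower[of b] lt[of b] by simp
  qed
qed

lemma PIO_minus_generators_subset: "PIO_minus_generators n \<subseteq> carrier (PIO_minus n)"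
proof
  fix g assume "g \<in> PIO_minus_generators n"
  then show "g \<in> carrier (PIO_minus n)"
    by (rule PIO_minus_generatorsE)
      (simp_all add: collapse_in_PIO_minus interval_id_in_PIO_minus)
qed

lemma card_PIO_minus_generators:
  assumes "n \<ge> 2"
  shows "card (PIO_minus_generators n) = 3 * n - 3"
proof -
  let ?C = "collapse n ` {1..n - 1}" and ?U = "(\<lambda>a. interval_id a n) ` {2..n}"
    and ?L = "interval_id 1 ` {1..n - 1}"
  have "inj_on (collapse n) {1..n - 1}"
  proof (rule linorder_inj_onI)
    fix i j assume "i < j" "i \<in> {1..n - 1}" "j \<in> {1..n - 1}"
    then have "collapse n i j \<noteq> collapse n j j" by (auto simp: collapse_def interval_map_apply)
    then show "collapse n i \<noteq> collapse n j" by metis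
  qed auto
  then have C: "card ?C = n - 1" by (simp add: card_image)
  have "inj_on (\<lambda>a. interval_id a n) {2..n}"
  proof (rule linorder_inj_onI)
    fix i j assume "i < j" "i \<in> {2..n}" "j \<in> {2..n}"
    then have "interval_id i n i \<noteq> interval_id j n i" by (auto simp: interval_map_apply)
    then show "interval_id i n \<noteq> interval_id j n" by metis
  qed auto
  then have U: "card ?U = n - 1" by (simp add: card_image)
  have "inj_on (interval_id 1) {1..n - 1}"
  proof (rule linorder_inj_onI)
    fix i j assume "i < j" "i \<in> {1..n - 1}" "j \<in> {1..n - 1}"
    then have "interval_id 1 i j \<noteq> interval_id 1 j j" by (auto simp: interval_map_apply)
    then show "interval_id 1 i \<noteq> interval_id 1 j" by metis
  qed auto
  then have L: "card ?L = n - 1" by (simp add: card_image)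
  have U1: "g 1 = None" if "g \<in> ?U" for g using that by (auto simp: interval_map_apply)
  have C1: "g 1 \<noteq> None" "g n \<noteq> None" if "g \<in> ?C" for g
    using that assms by (auto simp: collapse_def interval_map_apply)
  have L1: "g 1 \<noteq> None" "g n = None" if "g \<in> ?L" for g
    using that assms by (auto simp: interval_map_apply)
  have "?C \<inter> ?U = {}"
    by (rule Int_emptyI, drule C1(1), drule U1, simp)
  moreover have "(?C \<union> ?U) \<inter> ?L = {}"
    by (rule Int_emptyI, erule UnE, drule C1(2), drule L1(2), simp, drule U1, drule L1(1), simp)
  ultimately have "card (PIO_minus_generators n) = card ?C + card ?U + card ?L"
    unfolding PIO_minus_generators_def
    using card_Un_disjoint[of ?C ?U] card_Un_disjoint[of "?C \<union> ?U" ?L] by simp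
  then show ?thesis using C U L assms by simp
qed

section \<open>Generation\<close>

lemma submonoid_carrier: "monoid M \<Longrightarrow> submonoid (carrier M) M"
  by (simp add: monoid.m_closed monoid.one_closed submonoid.intro)

text \<open>A full map other than the identity repeats a value, say at \<open>i\<close> and \<open>i + 1\<close>. Raising
  all values after \<open>i\<close> by one removes this repetition, and collapsing the values \<open>f i\<close> and
  \<open>f i + 1\<close> afterwards restores \<open>f\<close>. The raised map has the larger last value \<open>f n + 1\<close>,
  which is still at most \<open>n\<close>, so the descent ends at the identity.\<close>

lemma full_map_in_submonoid:
  assumes H: "submonoid H (PIO_minus n)" and C: "collapse n ` {1..n - 1} \<subseteq> H"
    and "f 1 = 1"
    and "\<And>x. 1 \<le> x \<Longrightarrow> x < n \<Longrightarrow> f (Suc x) = f x \<or> f (Suc x) = Suc (f x)"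
  shows "interval_map 1 n f \<in> H"
  using assms(3,4)
proof (induction "n - f n" arbitrary: f rule: less_induct)
  case less
  have low: "1 \<le> f x \<and> f x \<le> x" if "1 \<le> x" "x \<le> n" for x
    using unit_steps_bounds[of f n x] less.prems that by simp
  show ?case
  proof (cases "\<exists>i. 1 \<le> i \<and> i < n \<and> f (Suc i) = f i")
    case False
    have "f x = x" if "1 \<le> x" "x \<le> n" for x
      using that
    proof (induction x rule: dec_induct)
      case (step m)
      have "\<not> (1 \<le> m \<and> m < n \<and> f (Suc m) = f m)" using False by blast
      then show ?case using less.prems(2)[of m] step by auto
    qed (use less.prems in simp)
    then have "interval_map 1 n f = \<one>\<^bsub>PIO_minus n\<^esub>"
      unfolding PIO_minus_one by (auto simp: interval_map_apply)
    then show ?thesis using submonoid.one_closed[OF H] by simp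
  next
    case True
    then obtain i where i: "1 \<le> i" "i < n" "f (Suc i) = f i" by blast
    define g where "g x = (if x \<le> i then f x else Suc (f x))" for x
    have g1: "g 1 = 1" using i less.prems by (simp add: g_def)
    have gstep: "g (Suc x) = g x \<or> g (Suc x) = Suc (g x)" if "1 \<le> x" "x < n" for x
      using less.prems(2)[OF that] i by (cases "x = i") (auto simp: g_def)
    have mono: "f x \<le> f y" if "x \<le> y" "1 \<le> x" "y \<le> n" for x y
      using less.prems(2) that by (rule unit_steps_mono)
    have glt: "g n \<le> n" using unit_steps_bounds[of g n n] g1 gstep i by simp
    then have "n - g n < n - f n" using i by (simp add: g_def)
    from less.hyps[OF this g1 gstep] have "interval_map 1 n g \<in> H" by blast
    moreover have "collapse n (f i) \<in> H"
      using C low[of i] i by auto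
    ultimately have "interval_map 1 n g \<otimes>\<^bsub>PIO_minus n\<^esub> collapse n (f i) \<in> H"
      by (rule submonoid.m_closed[OF H])
    moreover have "interval_map 1 n g \<otimes>\<^bsub>PIO_minus n\<^esub> collapse n (f i) = interval_map 1 n f"
    proof
      fix x
      show "(interval_map 1 n g \<otimes>\<^bsub>PIO_minus n\<^esub> collapse n (f i)) x = interval_map 1 n f x"
      proof (cases "1 \<le> x \<and> x \<le> n")
        case False
        then show ?thesis by (auto simp: PIO_minus_mult interval_map_apply)
      next
        case True
        show ?thesis
        proof (cases "x \<le> i")
          case below: True
          have "g x = f x" "f x \<le> f i" "1 \<le> f x" "f x \<le> n"
            using below mono[of x i] low[of x] True i by (simp_all add: g_def)
          then show ?thesis
            using True by (simp add: PIO_minus_mult interval_map_apply collapse_def)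
        next
          case above: False
          have "g x = Suc (f x)" "f i \<le> f x" using above mono[of i x] True i by (simp_all add: g_def)
          moreover have "Suc (f x) \<le> n" using mono[of x n] above True glt i by (simp add: g_def)
          ultimately show ?thesis
            using True by (simp add: PIO_minus_mult interval_map_apply collapse_def)
        qed
      qed
    qed
    ultimately show ?thesis by simp
  qed
qed

lemma interval_id_comp_full:
  assumes "1 \<le> a" "b \<le> n"
  shows "interval_id 1 b \<otimes>\<^bsub>PIO_minus n\<^esub> interval_id a n \<otimes>\<^bsub>PIO_minus n\<^esub> interval_map 1 n f
    = interval_map a b f"
  using assms by (auto simp: PIO_minus_mult interval_map_apply map_comp_def)

lemma PIO_minus_generated:
  assumes "n \<ge> 2"
  shows "submonoid_generated (PIO_minus n) (PIO_minus_generators n) = carrier (PIO_minus n)"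
proof
  show "submonoid_generated (PIO_minus n) (PIO_minus_generators n) \<subseteq> carrier (PIO_minus n)"
    using submonoid_carrier[OF monoid_PIO_minus] PIO_minus_generators_subset
    unfolding submonoid_generated_def by blast
next
  have "\<alpha> \<in> H" if \<alpha>: "\<alpha> \<in> carrier (PIO_minus n)"
    and H: "submonoid H (PIO_minus n)" and GH: "PIO_minus_generators n \<subseteq> H" for \<alpha> H
  proof -
    have C: "collapse n ` {1..n - 1} \<subseteq> H" using GH by (auto simp: PIO_minus_generators_def)
    have U: "interval_id a n \<in> H" if "1 \<le> a" "a \<le> n" for a
    proof (cases "a = 1")
      case True
      then show ?thesis using submonoid.one_closed[OF H] by (simp add: PIO_minus_one)
    next
      case False
      then show ?thesis using GH that by (auto simp: PIO_minus_generators_def)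
    qed
    have L: "interval_id 1 b \<in> H" if "1 \<le> b" "b \<le> n" for b
    proof (cases "b = n")
      case True
      then show ?thesis using submonoid.one_closed[OF H] by (simp add: PIO_minus_one)
    next
      case False
      then have "b \<in> {1..n - 1}" using that by auto
      then show ?thesis using GH by (auto simp: PIO_minus_generators_def)
    qed
    show ?thesis
    proof (cases "\<alpha> = Map.empty")
      case True
      have "interval_id 1 1 \<otimes>\<^bsub>PIO_minus n\<^esub> interval_id 2 n = \<alpha>"
        unfolding True by (auto simp: PIO_minus_mult interval_map_apply map_comp_def)
      then show ?thesis using submonoid.m_closed[OF H L[of 1] U[of 2]] assms by simp
    next
      case False
      then obtain a b f where ab: "1 \<le> a" "a \<le> b" "b \<le> n" and eq: "\<alpha> = interval_map a b f"
        and low: "\<And>x. a \<le> x \<Longrightarrow> x \<le> b \<Longrightarrow> 1 \<le> f x \<and> f x \<le> x"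
        and step: "\<And>x. a \<le> x \<Longrightarrow> x < b \<Longrightarrow> f (Suc x) = f x \<or> f (Suc x) = Suc (f x)"
        using PIO_minus_interval_mapE[OF \<alpha>] by metis
      \<comment> \<open>extend \<open>f\<close> below \<open>a\<close> by the identity, cut off at the value \<open>f a\<close>, and above \<open>b\<close> by a constant\<close>
      define g where "g x = (if x \<le> a then min x (f a) else f (min x b))" for x
      have g1: "g 1 = 1" using low[of a] ab by (simp add: g_def)
      have gstep: "g (Suc x) = g x \<or> g (Suc x) = Suc (g x)" if "1 \<le> x" "x < n" for x
      proof -
        consider "x < a" | "a \<le> x" "x < b" | "b \<le> x" by linarith
        then show ?thesis
        proof cases
          case 1
          then show ?thesis by (auto simp: g_def)
        next
          case 2
          then have "g x = f x" using low[of a] ab by (cases "x = a") (auto simp: g_def)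
          moreover have "g (Suc x) = f (Suc x)" using 2 by (simp add: g_def)
          ultimately show ?thesis using step[of x] 2 by simp
        next
          case 3
          then show ?thesis using low[of a] ab by (cases "x = a") (auto simp: g_def min_def)
        qed
      qed
      have "interval_map 1 n g \<in> H" using full_map_in_submonoid[OF H C, of g] g1 gstep by blast
      then have "interval_id 1 b \<otimes>\<^bsub>PIO_minus n\<^esub> interval_id a n \<otimes>\<^bsub>PIO_minus n\<^esub>
          interval_map 1 n g \<in> H"
        using L[of b] U[of a] ab by (simp add: submonoid.m_closed[OF H])
      moreover have "interval_map a b g = \<alpha>"
        unfolding eq using low[of a] ab by (auto simp: fun_eq_iff interval_map_apply g_def)
      ultimately show ?thesis using interval_id_comp_full[of a b n g] ab by simp
    qed
  qed
  then show "carrier (PIO_minus n) \<subseteq> submonoid_generated (PIO_minus n) (PIO_minus_generators n)"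
    unfolding submonoid_generated_def by blast
qed

section \<open>Every generating set contains the generators\<close>

text \<open>The complement of an irreducible element is a submonoid, and a generating set cannot lie in a
  proper submonoid.\<close>

lemma irreducible_in_generating_set:
  assumes "monoid M" and gen: "submonoid_generated M A = carrier M" and A: "A \<subseteq> carrier M"
    and g: "g \<in> carrier M" "g \<noteq> \<one>\<^bsub>M\<^esub>"
    and irr: "\<And>x y. x \<in> carrier M \<Longrightarrow> y \<in> carrier M \<Longrightarrow> x \<otimes>\<^bsub>M\<^esub> y = g \<Longrightarrow> x = g \<or> y = g"
  shows "g \<in> A"
proof (rule ccontr)
  assume "g \<notin> A"
  interpret monoid M by fact
  have "submonoid (carrier M - {g}) M"
    using irr g by unfold_locales auto
  then have "submonoid_generated M A \<subseteq> carrier M - {g}"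
    using A \<open>g \<notin> A\<close> unfolding submonoid_generated_def by blast
  then show False using gen g by blast
qed

text \<open>The point can only move down, in two stages, so it cannot move at all.\<close>

lemma factors_fix:
  assumes "\<beta> \<in> carrier (PIO_minus n)" "\<gamma> \<in> carrier (PIO_minus n)"
    and "(\<beta> \<otimes>\<^bsub>PIO_minus n\<^esub> \<gamma>) x = Some x"
  shows "\<beta> x = Some x" "\<gamma> x = Some x"
proof -
  obtain y where y: "\<beta> x = Some y" "\<gamma> y = Some x"
    using assms(3) by (auto simp: PIO_minus_mult map_comp_def split: option.splits)
  then have "y = x"
    using PIO_minus_bounds(2)[OF assms(1) y(1)] PIO_minus_bounds(2)[OF assms(2) y(2)] by simp
  then show "\<beta> x = Some x" "\<gamma> x = Some x" using y by auto
qed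

lemma upper_id_irreducible:
  assumes a: "2 \<le> a" "a \<le> n"
    and M: "\<beta> \<in> carrier (PIO_minus n)" "\<gamma> \<in> carrier (PIO_minus n)"
    and prod: "\<beta> \<otimes>\<^bsub>PIO_minus n\<^esub> \<gamma> = interval_id a n"
  shows "\<beta> = interval_id a n \<or> \<gamma> = interval_id a n"
proof -
  have fixed: "\<beta> x = Some x" "\<gamma> x = Some x" if "a \<le> x" "x \<le> n" for x
    using factors_fix[OF M, of x] that by (simp_all add: prod interval_map_apply)
  \<comment> \<open>a proper extension of the partial identity reaches \<open>a - 1\<close>, because domains are intervals, and fixes it, because steps are at most one\<close>
  have ext: "\<delta> (a - 1) = Some (a - 1)"
    if \<delta>: "\<delta> \<in> carrier (PIO_minus n)" "\<And>x. a \<le> x \<Longrightarrow> x \<le> n \<Longrightarrow> \<delta> x = Some x"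
      "\<delta> \<noteq> interval_id a n" for \<delta>
  proof -
    obtain x where x: "\<delta> x \<noteq> interval_id a n x" using \<delta>(3) by blast
    have "x < a \<or> x > n"
    proof (rule ccontr)
      assume "\<not> ?thesis"
      then show False using \<delta>(2)[of x] x by (simp add: interval_map_apply not_less)
    qed
    then obtain y where y: "\<delta> x = Some y" using x by (auto simp: interval_map_apply)
    then have "x < a" using PIO_minus_bounds(3)[OF \<delta>(1) y] \<open>x < a \<or> x > n\<close> by simp
    then have "a - 1 \<in> dom \<delta>"
      using PIO_minus_dom_convex[OF \<delta>(1), of x a "a - 1"] domI[of \<delta> x, OF y]
        domI[of \<delta> a, OF \<delta>(2)[of a]] a by simp
    then obtain z where z: "\<delta> (a - 1) = Some z" by blast
    have "a = z \<or> a = Suc z"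
      using PIO_minus_unit_step[OF \<delta>(1) z, of a] \<delta>(2)[of a] a by simp
    then show ?thesis using PIO_minus_bounds(2)[OF \<delta>(1) z] z a by auto
  qed
  show ?thesis
  proof (rule ccontr)
    assume "\<not> ?thesis"
    then have "\<beta> (a - 1) = Some (a - 1)" "\<gamma> (a - 1) = Some (a - 1)"
      using ext[OF M(1) fixed(1)] ext[OF M(2) fixed(2)] by simp_all
    then have "(\<beta> \<otimes>\<^bsub>PIO_minus n\<^esub> \<gamma>) (a - 1) = Some (a - 1)" by (simp add: PIO_minus_mult)
    then show False using a by (simp add: prod interval_map_apply split: if_splits)
  qed
qed

lemma lower_id_irreducible:
  assumes b: "1 \<le> b" "b < n"
    and M: "\<beta> \<in> carrier (PIO_minus n)" "\<gamma> \<in> carrier (PIO_minus n)"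
    and prod: "\<beta> \<otimes>\<^bsub>PIO_minus n\<^esub> \<gamma> = interval_id 1 b"
  shows "\<beta> = interval_id 1 b \<or> \<gamma> = interval_id 1 b"
proof -
  have fixed: "\<beta> x = Some x" "\<gamma> x = Some x" if "1 \<le> x" "x \<le> b" for x
    using factors_fix[OF M, of x] that by (simp_all add: prod interval_map_apply)
  \<comment> \<open>unlike at the lower end, an extension need not fix \<open>b + 1\<close>, but it keeps it in \<open>{b, b + 1}\<close>\<close>
  have ext: "Suc b \<in> dom \<delta>"
    if \<delta>: "\<delta> \<in> carrier (PIO_minus n)" "\<And>x. 1 \<le> x \<Longrightarrow> x \<le> b \<Longrightarrow> \<delta> x = Some x"
      "\<delta> \<noteq> interval_id 1 b" for \<delta>
  proof -
    obtain x where x: "\<delta> x \<noteq> interval_id 1 b x" using \<delta>(3) by blast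
    have "x < 1 \<or> x > b"
    proof (rule ccontr)
      assume "\<not> ?thesis"
      then show False using \<delta>(2)[of x] x by (simp add: interval_map_apply not_less)
    qed
    then obtain y where y: "\<delta> x = Some y" using x by (auto simp: interval_map_apply)
    then have "x > b"
      using PIO_minus_bounds[OF \<delta>(1) y] \<open>x < 1 \<or> x > b\<close> by simp
    then show ?thesis
      using PIO_minus_dom_convex[OF \<delta>(1), of b x "Suc b"] domI[of \<delta> x, OF y]
        domI[of \<delta> b, OF \<delta>(2)[of b]] b by simp
  qed
  show ?thesis
  proof (rule ccontr)
    assume "\<not> ?thesis"
    then have d: "Suc b \<in> dom \<beta>" "Suc b \<in> dom \<gamma>"
      using ext[OF M(1) fixed(1)] ext[OF M(2) fixed(2)] by simp_all
    then obtain z where z: "\<beta> (Suc b) = Some z" by blast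
    have "z = b \<or> z = Suc b" using PIO_minus_unit_step[OF M(1) _ z, of b] fixed(1)[of b] b by simp
    then have "z \<in> dom \<gamma>" using d fixed(2)[of b] b by auto
    then have "(\<beta> \<otimes>\<^bsub>PIO_minus n\<^esub> \<gamma>) (Suc b) \<noteq> None" using z by (auto simp: PIO_minus_mult)
    then show False by (simp add: prod interval_map_apply)
  qed
qed

text \<open>Both factors being order-decreasing, the values of \<open>\<beta>\<close> lie between those of the collapsing
  map and those of the identity, so \<open>\<beta>\<close> fixes \<open>1, \<dots>, i\<close> and sends \<open>i + 1\<close> to \<open>i\<close> or
  \<open>i + 1\<close>. In the first case its unit steps never let it catch up with the identity, so \<open>\<beta>\<close> is the
  collapsing map. In the second case \<open>\<beta>\<close> cannot repeat a value above \<open>i\<close>, where the product is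
  injective, so it is the identity and \<open>\<gamma>\<close> is the collapsing map.\<close>

lemma collapse_irreducible:
  assumes i: "1 \<le> i" "i < n"
    and M: "\<beta> \<in> carrier (PIO_minus n)" "\<gamma> \<in> carrier (PIO_minus n)"
    and prod: "\<beta> \<otimes>\<^bsub>PIO_minus n\<^esub> \<gamma> = collapse n i"
  shows "\<beta> = collapse n i \<or> \<gamma> = collapse n i"
proof -
  have "\<exists>y. \<beta> x = Some y \<and> \<gamma> y = collapse n i x" if "1 \<le> x" "x \<le> n" for x
  proof -
    have "collapse n i x \<noteq> None" using that by (simp add: collapse_def interval_map_apply)
    then show ?thesis
      by (cases "\<beta> x") (auto simp: PIO_minus_mult simp flip: prod)
  qed
  then obtain f where f: "\<And>x. 1 \<le> x \<Longrightarrow> x \<le> n \<Longrightarrow> \<beta> x = Some (f x) \<and> \<gamma> (f x) = collapse n i x"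
    by metis
  have undef: "\<delta> x = None" if "\<delta> \<in> carrier (PIO_minus n)" "x < 1 \<or> n < x" for \<delta> x
    using PIO_minus_bounds[OF that(1), of x] that(2) by (cases "\<delta> x") fastforce+
  have upper: "f x \<le> x" if "1 \<le> x" "x \<le> n" for x
    using PIO_minus_bounds(2)[OF M(1), of x] f[OF that] by blast
  have lower: "(if x \<le> i then x else x - 1) \<le> f x" if "1 \<le> x" "x \<le> n" for x
    using PIO_minus_bounds(2)[OF M(2), of "f x"] f[OF that] that
    by (simp add: collapse_def interval_map_apply)
  have f_step: "f (Suc x) = f x \<or> f (Suc x) = Suc (f x)" if "1 \<le> x" "x < n" for x
    using PIO_minus_unit_step[OF M(1), of x] f[of x] f[of "Suc x"] that by simp
  show ?thesis
  proof (cases "f (Suc i) = i")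
    case True
    have "f x \<le> x - 1" if "Suc i \<le> x" "x \<le> n" for x
      using that
    proof (induction x rule: dec_induct)
      case (step m)
      then show ?case using f_step[of m] by auto
    qed (use True in simp)
    then have "f x = (if x \<le> i then x else x - 1)" if "1 \<le> x" "x \<le> n" for x
      using upper[OF that] lower[OF that] that by (cases "x \<le> i") (auto simp: le_antisym)
    then have "\<beta> x = collapse n i x" for x
      using f[of x] undef[OF M(1), of x] by (auto simp: collapse_def interval_map_apply)
    then show ?thesis by blast
  next
    case False
    have "f x = x" if "Suc i \<le> x" "x \<le> n" for x
      using that
    proof (induction x rule: dec_induct)
      case base
      then show ?case using False upper[of "Suc i"] lower[of "Suc i"] i by auto
    next
      case (step m)
      have "collapse n i (Suc m) \<noteq> collapse n i m"
        using step i by (auto simp: collapse_def interval_map_apply)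
      then have "f (Suc m) \<noteq> f m" using f[of m] f[of "Suc m"] step i by auto
      then show ?case using f_step[of m] step by auto
    qed
    then have "f x = x" if "1 \<le> x" "x \<le> n" for x
      using upper[OF that] lower[OF that] that by (cases "x \<le> i") (auto simp: le_antisym)
    then have "\<gamma> x = collapse n i x" for x
      using f[of x] undef[OF M(2), of x] by (auto simp: collapse_def interval_map_apply)
    then show ?thesis by blast
  qed
qed

lemma PIO_minus_generators_irreducible:
  assumes "g \<in> PIO_minus_generators n"
    and "\<beta> \<in> carrier (PIO_minus n)" "\<gamma> \<in> carrier (PIO_minus n)"
    and "\<beta> \<otimes>\<^bsub>PIO_minus n\<^esub> \<gamma> = g"
  shows "\<beta> = g \<or> \<gamma> = g"
proof -
  consider (C) i where "1 \<le> i" "i < n" "g = collapse n i"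
    | (U) a where "2 \<le> a" "a \<le> n" "g = interval_id a n"
    | (L) b where "1 \<le> b" "b < n" "g = interval_id 1 b"
    using assms(1) by (rule PIO_minus_generatorsE)
  then show ?thesis
  proof cases
    case C
    then show ?thesis using collapse_irreducible assms(2-4) by simp
  next
    case U
    then show ?thesis using upper_id_irreducible assms(2-4) by simp
  next
    case L
    then show ?thesis using lower_id_irreducible assms(2-4) by simp
  qed
qed

lemma one_notin_PIO_minus_generators: "\<one>\<^bsub>PIO_minus n\<^esub> \<notin> PIO_minus_generators n"
proof
  assume "\<one>\<^bsub>PIO_minus n\<^esub> \<in> PIO_minus_generators n"
  then consider (C) i where "1 \<le> i" "i < n" "interval_id 1 n = collapse n i"
    | (U) a where "2 \<le> a" "a \<le> n" "interval_id 1 n = interval_id a n"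
    | (L) b where "1 \<le> b" "b < n" "interval_id 1 n = interval_id 1 b"
    unfolding PIO_minus_one by (rule PIO_minus_generatorsE)
  then show False
  proof cases
    case C
    from fun_cong[OF C(3), of n] show False
      using C(1,2) by (auto simp: collapse_def interval_map_apply)
  next
    case U
    from fun_cong[OF U(3), of 1] show False
      using U(1,2) by (simp add: interval_map_apply)
  next
    case L
    from fun_cong[OF L(3), of n] show False
      using L(1,2) by (simp add: interval_map_apply)
  qed
qed

theorem theorem17:
  fixes n :: nat
  assumes "n \<ge> 2"
  shows "monoid_rank (PIO_minus n) = 3 * n - 3"
  unfolding monoid_rank_def
proof (rule Least_equality)
  have "finite (PIO_minus_generators n)" by (simp add: PIO_minus_generators_def)
  then show "\<exists>A. A \<subseteq> carrier (PIO_minus n) \<and> finite A \<and> card A = 3 * n - 3 \<and>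
      submonoid_generated (PIO_minus n) A = carrier (PIO_minus n)"
    using PIO_minus_generators_subset card_PIO_minus_generators[OF assms]
      PIO_minus_generated[OF assms] by blast
next
  fix k
  assume "\<exists>A. A \<subseteq> carrier (PIO_minus n) \<and> finite A \<and> card A = k \<and>
      submonoid_generated (PIO_minus n) A = carrier (PIO_minus n)"
  then obtain A where A: "A \<subseteq> carrier (PIO_minus n)" "finite A" "card A = k"
    "submonoid_generated (PIO_minus n) A = carrier (PIO_minus n)" by blast
  have "PIO_minus_generators n \<subseteq> A"
  proof
    fix g assume g: "g \<in> PIO_minus_generators n"
    then show "g \<in> A"
      using irreducible_in_generating_set[OF monoid_PIO_minus A(4,1), of g]
        PIO_minus_generators_subset[of n] PIO_minus_generators_irreducible[OF g]
        one_notin_PIO_minus_generators[of n] by blast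
  qed
  then show "3 * n - 3 \<le> k"
    using card_mono[OF A(2)] card_PIO_minus_generators[OF assms] A(3) by metis
qed

end
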